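(* Let $(\Omega,\nu)$ be an atomless Borel probability space and let $(W_n)_n$ be a sequence of graphons on $\Omega$ converging to a graphon $W$ in the cut-norm. Then $\omega_{\mathrm{frac}}(W)\le\liminf_{n\to\infty}\omega_{\mathrm{frac}}(W_n)$.
   Context: A graphon is a symmetric measurable $W:\Omega\times\Omega\to[0,1]$. A measurable set $A$ is independent in $W$ if $W=0$ a.e. on $A\times A$; $\mathcal I(W)$ is the set of independent sets. A fractional clique of $W$ is a measurable $f:\Omega\to[0,\infty)$ with $\int_I f\le1$ for every $I\in\mathcal I(W)$, and $\omega_{\mathrm{frac}}(W)=\sup\int_\Omega f$ over fractional cliques. The cut-norm is $\|U\|_\square=\sup_{S,T\subseteq\Omega}|\int_{S\times T}U|$. *)

theory Defs
  imports "HOL-Probability.Probability"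
begin

text \<open>A standard Borel space: the \<open>\<sigma>\<close>-algebra is generated by the open sets of some Polish
  topology (completely metrizable and second countable, i.e. completely metrizable and separable)
  on the carrier.\<close>

definition standard_borel :: "'a measure \<Rightarrow> bool" where
  "standard_borel M \<longleftrightarrow>
     (\<exists>T. completely_metrizable_space T \<and> second_countable T \<and>
          topspace T = space M \<and> sets M = sigma_sets (space M) {U. openin T U})"

definition atomless :: "'a measure \<Rightarrow> bool" where
  "atomless M \<longleftrightarrow>
     (\<forall>A\<in>sets M. emeasure M A > 0 \<longrightarrow>
        (\<exists>B\<in>sets M. B \<subseteq> A \<and> 0 < emeasure M B \<and> emeasure M B < emeasure M A))"

definition graphon :: "'a measure \<Rightarrow> ('a \<times> 'a \<Rightarrow> real) \<Rightarrow> bool" where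
  "graphon M W \<longleftrightarrow>
     W \<in> borel_measurable (M \<Otimes>\<^sub>M M) \<and>
     (\<forall>x\<in>space M. \<forall>y\<in>space M. W (x, y) = W (y, x) \<and> 0 \<le> W (x, y) \<and> W (x, y) \<le> 1)"

definition independent_sets :: "'a measure \<Rightarrow> ('a \<times> 'a \<Rightarrow> real) \<Rightarrow> 'a set set" where
  "independent_sets M W = {A \<in> sets M. AE p in M \<Otimes>\<^sub>M M. p \<in> A \<times> A \<longrightarrow> W p = 0}"

text \<open>Integrals of non-negative functions are taken in \<open>[0,\<infinity>]\<close>. A fractional clique need not be
  integrable, and the fractional clique number may be \<open>\<infinity>\<close> (for instance when \<open>W = 1\<close>).\<close>

definition fractional_cliques :: "'a measure \<Rightarrow> ('a \<times> 'a \<Rightarrow> real) \<Rightarrow> ('a \<Rightarrow> real) set" where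
  "fractional_cliques M W =
     {f \<in> borel_measurable M. (\<forall>x\<in>space M. 0 \<le> f x) \<and>
        (\<forall>I\<in>independent_sets M W. (\<integral>\<^sup>+x\<in>I. ennreal (f x) \<partial>M) \<le> 1)}"

definition omega_frac :: "'a measure \<Rightarrow> ('a \<times> 'a \<Rightarrow> real) \<Rightarrow> ennreal" where
  "omega_frac M W = (SUP f\<in>fractional_cliques M W. \<integral>\<^sup>+x. ennreal (f x) \<partial>M)"

text \<open>The supremum is taken in the reals, so this is meaningful when \<open>U\<close> is integrable, in particular
  for differences of graphons on a probability space, where the values are bounded by 1.\<close>

definition cut_norm :: "'a measure \<Rightarrow> ('a \<times> 'a \<Rightarrow> real) \<Rightarrow> real" where
  "cut_norm M U =
     (SUP (S, T)\<in>sets M \<times> sets M. \<bar>set_lebesgue_integral (M \<Otimes>\<^sub>M M) (S \<times> T) U\<bar>)"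

end

theory Submission
  imports Defs
begin

text \<open>Let \<open>f\<close> be a bounded fractional clique of \<open>W\<close>. It suffices that \<open>f / (1 + \<epsilon>)\<close> is a fractional
  clique of \<open>W\<^sub>n\<close> for all large \<open>n\<close>. If not, there are sets \<open>I\<^sub>j\<close>, independent in \<open>W\<^bsub>s j\<^esub>\<close>, with
  \<open>\<integral>\<^bsub>I\<^sub>j\<^esub> f > 1 + \<epsilon>\<close>. Cut-norm convergence gives \<open>\<integral>\<^bsub>I\<^sub>j \<times> I\<^sub>j\<^esub> W \<rightarrow> 0\<close>, so \<open>I\<^sub>j \<times> I\<^sub>j\<close> meets the support \<open>S\<close> of
  \<open>W\<close> in a set of vanishing measure. Weak limits of the \<open>I\<^sub>j\<close> can be avoided: along a subsequence the
  section measures \<open>h\<^sub>j x = \<nu> (I\<^sub>j \<inter> S\<^sub>x)\<close> converge pointwise to some \<open>h\<close>, and after making the rates of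
  convergence summable, two applications of Borel-Cantelli show for \<open>B = limsup I\<^sub>j\<close> first
  \<open>\<integral>\<^bsub>B\<^esub> h = 0\<close> and then that \<open>(B \<times> B) \<inter> S\<close> is null. Thus \<open>B\<close> is independent in \<open>W\<close>, although
  \<open>\<integral>\<^bsub>B\<^esub> f \<ge> limsup \<integral>\<^bsub>I\<^sub>j\<^esub> f \<ge> 1 + \<epsilon>\<close>.\<close>

section \<open>Convergence of real sequences and of countable families\<close>

text \<open>The approximation is uniform in \<open>j\<close>, so the Cauchy property passes from
  \<open>g\<close> to \<open>f\<close> and no limit has to be named.\<close>

lemma convergent_if_uniformly_approximable:
  fixes f :: "nat \<Rightarrow> real"
  assumes "\<And>e. e > 0 \<Longrightarrow> \<exists>g. convergent g \<and> (\<forall>j. \<bar>f j - g j\<bar> \<le> e)"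
  shows "convergent f"
proof -
  have "Cauchy f"
  proof (rule CauchyI)
    fix e :: real assume "e > 0"
    with assms[of "e/4"] obtain g where g: "convergent g" "\<And>j. \<bar>f j - g j\<bar> \<le> e/4" by auto
    then obtain N where N: "\<And>m n. m \<ge> N \<Longrightarrow> n \<ge> N \<Longrightarrow> norm (g m - g n) < e/2"
      using CauchyD[OF convergent_Cauchy[OF g(1)], of "e/2"] \<open>e > 0\<close> by auto
    have "norm (f m - f n) < e" if "m \<ge> N" "n \<ge> N" for m n
      using g(2)[of m] g(2)[of n] N[OF that] unfolding real_norm_def by linarith
    then show "\<exists>N. \<forall>m\<ge>N. \<forall>n\<ge>N. norm (f m - f n) < e"
      by blast
  qed
  then show ?thesis by (rule Cauchy_convergent)
qed

text \<open>Sequential compactness of a countable product of intervals takes the place of an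
  explicit diagonal argument: after enumerating \<open>T\<close>, convergence in the product is
  convergence at every coordinate.\<close>

lemma countable_family_convergent_subseq:
  fixes F :: "nat \<Rightarrow> 'b \<Rightarrow> real"
  assumes "countable T" and "\<And>j t. t \<in> T \<Longrightarrow> F j t \<in> {a..b}"
  obtains r :: "nat \<Rightarrow> nat" where "strict_mono r" "\<And>t. t \<in> T \<Longrightarrow> convergent (\<lambda>j. F (r j) t)"
proof (cases "T = {}")
  case True
  then show ?thesis using that[of id] by (auto simp: strict_mono_def)
next
  case False
  define G where "G j k = F j (from_nat_into T k)" for j k
  have "compact (Pi\<^sub>E UNIV (\<lambda>k::nat. {a..b}))"
    using compactin_PiE[of "\<lambda>_. euclidean" "UNIV :: nat set" "\<lambda>_. {a..b}"]
    by (simp add: euclidean_product_topology)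
  then have "seq_compact (Pi\<^sub>E UNIV (\<lambda>k::nat. {a..b}))"
    by (rule compact_imp_seq_compact)
  moreover have "\<forall>j. G j \<in> Pi\<^sub>E UNIV (\<lambda>k::nat. {a..b})"
    using assms(2) from_nat_into[OF False] by (auto simp: G_def PiE_def)
  ultimately obtain l r where r: "strict_mono r" "(G \<circ> r) \<longlonglongrightarrow> l"
    by (meson seq_compactE)
  have "(\<lambda>j. G (r j) k) \<longlonglongrightarrow> l k" for k
  proof -
    have "continuous_on UNIV (\<lambda>g :: nat \<Rightarrow> real. g k)"
      by (rule continuous_on_product_then_coordinatewise[OF continuous_on_id])
    from continuous_on_tendsto_compose[OF this r(2)] show ?thesis by simp
  qed
  moreover have "\<exists>k. t = from_nat_into T k" if "t \<in> T" for t
    using from_nat_into_surj[OF assms(1) that] by metis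
  ultimately show ?thesis
    using that[OF r(1)] unfolding G_def convergent_def by metis
qed

section \<open>Section measures and limsup sets in a finite measure space\<close>

context finite_measure
begin

text \<open>The countable witness makes the property stable under countable unions, so that a single
  diagonal subsequence suffices for the whole product \<open>\<sigma>\<close>-algebra.\<close>

lemma sections_countably_determined:
  assumes "S \<in> sets (M \<Otimes>\<^sub>M M)"
  obtains T where "countable T" "T \<subseteq> sets M"
    "\<And>I x. (\<And>j. I j \<in> sets M) \<Longrightarrow> (\<And>t. t \<in> T \<Longrightarrow> convergent (\<lambda>j::nat. measure M (I j \<inter> t))) \<Longrightarrow>
      x \<in> space M \<Longrightarrow> convergent (\<lambda>j. measure M (I j \<inter> Pair x -` S))"
proof -
  \<comment> \<open>All sequences \<open>I\<close> and all points \<open>x\<close> are quantified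
    inside \<open>P\<close>, so that \<open>T\<close> depends on \<open>S\<close> alone.\<close>
  define P where "P T S \<longleftrightarrow> countable T \<and> T \<subseteq> sets M \<and>
    (\<forall>I. range I \<subseteq> sets M \<longrightarrow> (\<forall>t\<in>T. convergent (\<lambda>j::nat. measure M (I j \<inter> t))) \<longrightarrow>
      (\<forall>x\<in>space M. convergent (\<lambda>j. measure M (I j \<inter> Pair x -` S))))"
    for T and S :: "('a \<times> 'a) set"
  have PI: "P T S" if "countable T" "T \<subseteq> sets M"
    "\<And>I x. (\<And>j. I j \<in> sets M) \<Longrightarrow> (\<And>t. t \<in> T \<Longrightarrow> convergent (\<lambda>j::nat. measure M (I j \<inter> t))) \<Longrightarrow>
        x \<in> space M \<Longrightarrow> convergent (\<lambda>j. measure M (I j \<inter> Pair x -` S))"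
    for T S
    using that unfolding P_def by (simp add: image_subset_iff)
  have PD: "countable T" "T \<subseteq> sets M"
      "(\<And>j. I j \<in> sets M) \<Longrightarrow> (\<And>t. t \<in> T \<Longrightarrow> convergent (\<lambda>j::nat. measure M (I j \<inter> t))) \<Longrightarrow>
        x \<in> space M \<Longrightarrow> convergent (\<lambda>j. measure M (I j \<inter> Pair x -` S))"
    if "P T S" for T S I x
    using that unfolding P_def by (auto simp: image_subset_iff)
  let ?G = "{a \<times> b | a b. a \<in> sets M \<and> b \<in> sets M}"
  have G: "?G \<subseteq> Pow (space M \<times> space M)"
    using sets.space_closed by blast
  have S: "S \<in> sigma_sets (space M \<times> space M) ?G"
    using assms by (simp add: sets_pair_measure)
  have sg: "A \<in> sets (M \<Otimes>\<^sub>M M)" if "A \<in> sigma_sets (space M \<times> space M) ?G" for A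
    using that by (simp add: sets_pair_measure)
  \<comment> \<open>Dynkin induction: rectangles are stable under intersection and generate the
    product, so beyond them only complements and disjoint unions have to be treated.\<close>
  have "\<exists>T. P T S"
  proof (rule sigma_sets_induct_disjoint[OF Int_stable_pair_measure_generator G S,
        where P = "\<lambda>S. \<exists>T. P T S"])
    fix A assume "A \<in> ?G"
    then obtain a b where "A = a \<times> b" "a \<in> sets M" "b \<in> sets M" by auto
    moreover have "Pair x -` (a \<times> b) = (if x \<in> a then b else {})" for x by auto
    ultimately show "\<exists>T. P T A"
      by (intro exI[of _ "{b}"] PI) (auto simp: convergent_const)
  next
    show "\<exists>T. P T {}" by (intro exI[of _ "{}"] PI) (auto simp: convergent_const)
  next
    fix A assume A: "A \<in> sigma_sets (space M \<times> space M) ?G" and "\<exists>T. P T A"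
    then obtain T where T: "P T A" by auto
    show "\<exists>T. P T (space M \<times> space M - A)"
    \<comment> \<open>The section of the complement is a difference whose first term is
      \<open>I j\<close> itself; adding \<open>space M\<close> to the witness makes the measures of
      the \<open>I j\<close> converge.\<close>
    proof (intro exI[of _ "insert (space M) T"] PI)
      fix I :: "nat \<Rightarrow> 'a set" and x
      assume I[measurable]: "\<And>j. I j \<in> sets M"
        and conv: "\<And>t. t \<in> insert (space M) T \<Longrightarrow> convergent (\<lambda>j. measure M (I j \<inter> t))"
        and x: "x \<in> space M"
      have [measurable]: "Pair x -` A \<in> sets M" by (rule sets_Pair1[OF sg[OF A]])
      have "measure M (I j \<inter> Pair x -` (space M \<times> space M - A)) =
          measure M (I j \<inter> space M) - measure M (I j \<inter> Pair x -` A)" for j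
      proof -
        have "I j \<inter> Pair x -` (space M \<times> space M - A) = I j \<inter> space M - (I j \<inter> Pair x -` A)"
          using x sets.sets_into_space[of "I j" M] by auto
        moreover have "I j \<inter> Pair x -` A \<subseteq> I j \<inter> space M"
          using sets.sets_into_space[of "I j" M] by auto
        ultimately show ?thesis by (simp add: finite_measure_Diff)
      qed
      moreover have "convergent (\<lambda>j. measure M (I j \<inter> Pair x -` A))"
        using conv by (intro PD(3)[OF T I _ x]) auto
      ultimately show "convergent (\<lambda>j. measure M (I j \<inter> Pair x -` (space M \<times> space M - A)))"
        using conv[of "space M"] by (simp add: convergent_diff)
    qed (use PD(1,2)[OF T] in auto)
  next
    fix A :: "nat \<Rightarrow> ('a \<times> 'a) set"
    assume disj: "disjoint_family A" and A: "range A \<subseteq> sigma_sets (space M \<times> space M) ?G"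
      and "\<And>i. \<exists>T. P T (A i)"
    then obtain T where T: "\<And>i. P (T i) (A i)" by metis
    show "\<exists>T. P T (\<Union>(range A))"
    proof (intro exI[of _ "\<Union>(range T)"] PI)
      show "countable (\<Union>(range T))" using PD(1)[OF T] by auto
      show "\<Union>(range T) \<subseteq> sets M" using PD(2)[OF T] by auto
      fix I :: "nat \<Rightarrow> 'a set" and x
      assume I[measurable]: "\<And>j. I j \<in> sets M"
        and T_conv: "\<And>t. t \<in> \<Union>(range T) \<Longrightarrow> convergent (\<lambda>j. measure M (I j \<inter> t))"
        and x: "x \<in> space M"
      have Am[measurable]: "Pair x -` A i \<in> sets M" for i
        using A by (intro sets_Pair1[OF sg]) auto
      have conv: "convergent (\<lambda>j. measure M (I j \<inter> Pair x -` A i))" for i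
        using T_conv by (intro PD(3)[OF T I _ x]) auto
      have disj': "disjoint_family (\<lambda>i. Pair x -` A i)"
        using disj by (auto simp: disjoint_family_on_def)
      show "convergent (\<lambda>j. measure M (I j \<inter> Pair x -` \<Union>(range A)))"
      \<comment> \<open>Truncating the union at \<open>N\<close> leaves a finite sum of convergent
        sequences. The error is at most the mass of the remaining sections, a bound free of
        \<open>j\<close> because intersecting with \<open>I j\<close> only shrinks them.\<close>
      proof (rule convergent_if_uniformly_approximable)
        fix e :: real assume "e > 0"
        have "(\<lambda>i. measure M (Pair x -` A i)) sums measure M (\<Union>i. Pair x -` A i)"
          using Am disj' by (intro finite_measure_UNION) auto
        then have "(\<lambda>N. measure M (\<Union>i. Pair x -` A i) - (\<Sum>i<N. measure M (Pair x -` A i)))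
            \<longlonglongrightarrow> measure M (\<Union>i. Pair x -` A i) - measure M (\<Union>i. Pair x -` A i)"
          unfolding sums_def by (intro tendsto_intros)
        then have "\<forall>\<^sub>F N in sequentially.
            measure M (\<Union>i. Pair x -` A i) - (\<Sum>i<N. measure M (Pair x -` A i)) < e"
          using \<open>e > 0\<close> by (intro order_tendstoD(2)[of _ 0]) auto
        then obtain N where
          N: "measure M (\<Union>i. Pair x -` A i) - (\<Sum>i<N. measure M (Pair x -` A i)) < e"
          by (auto simp: eventually_sequentially)
        have fin: "measure M (\<Union>i<N. J \<inter> Pair x -` A i) = (\<Sum>i<N. measure M (J \<inter> Pair x -` A i))"
          if [measurable]: "J \<in> sets M" for J
          using disj' by (intro finite_measure_finite_Union) (auto simp: disjoint_family_on_def)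
        let ?V = "\<Union>i. Pair x -` A i" and ?VN = "\<Union>i<N. Pair x -` A i"
        have tail: "measure M (?V - ?VN) < e"
        proof -
          have "measure M (?V - ?VN) = measure M ?V - measure M ?VN"
            by (intro finite_measure_Diff) auto
          moreover have "measure M ?VN = (\<Sum>i<N. measure M (Pair x -` A i))"
            using disj' by (intro finite_measure_finite_Union) (auto simp: disjoint_family_on_def)
          ultimately show ?thesis using N by simp
        qed
        have "\<bar>measure M (I j \<inter> Pair x -` \<Union>(range A)) - (\<Sum>i<N. measure M (I j \<inter> Pair x -` A i))\<bar> \<le> e" for j
        proof -
          have "measure M (I j \<inter> ?V - I j \<inter> ?VN) = measure M (I j \<inter> ?V) - measure M (I j \<inter> ?VN)"
            by (intro finite_measure_Diff) auto
          moreover have "measure M (I j \<inter> ?V - I j \<inter> ?VN) \<le> measure M (?V - ?VN)"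
            by (intro finite_measure_mono) auto
          moreover have "measure M (I j \<inter> ?VN) = (\<Sum>i<N. measure M (I j \<inter> Pair x -` A i))"
            unfolding fin[OF I, symmetric] by (rule arg_cong[of _ _ "measure M"]) blast
          moreover have "measure M (I j \<inter> Pair x -` \<Union>(range A)) = measure M (I j \<inter> ?V)"
            by (simp only: vimage_Union image_image)
          ultimately show ?thesis
            using tail measure_nonneg[of M "I j \<inter> ?V - I j \<inter> ?VN"] by linarith
        qed
        moreover have "convergent (\<lambda>j. \<Sum>i<N. measure M (I j \<inter> Pair x -` A i))"
          using conv by (intro convergent_sum) auto
        ultimately show "\<exists>g. convergent g \<and>
            (\<forall>j. \<bar>measure M (I j \<inter> Pair x -` \<Union>(range A)) - g j\<bar> \<le> e)" by blast
      qed
    qed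
  qed
  then obtain T where "P T S" ..
  from PD[OF this] show thesis by (rule that)
qed

text \<open>There may be uncountably many sections, but their convergence is controlled by the
  countable family \<open>T\<close>, so one subsequence serves all \<open>x\<close> at once.\<close>

lemma sections_convergent_subseq:
  assumes "S \<in> sets (M \<Otimes>\<^sub>M M)" and "\<And>j. I j \<in> sets M"
  obtains r :: "nat \<Rightarrow> nat" where "strict_mono r"
    "\<And>x. x \<in> space M \<Longrightarrow> convergent (\<lambda>j. measure M (I (r j) \<inter> Pair x -` S))"
proof (rule sections_countably_determined[OF assms(1)])
  fix T
  assume T: "countable T" "T \<subseteq> sets M"
    and sections: "\<And>I x. (\<And>j. I j \<in> sets M) \<Longrightarrow> (\<And>t. t \<in> T \<Longrightarrow> convergent (\<lambda>j::nat. measure M (I j \<inter> t))) \<Longrightarrow>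
        x \<in> space M \<Longrightarrow> convergent (\<lambda>j. measure M (I j \<inter> Pair x -` S))"
  obtain r :: "nat \<Rightarrow> nat" where r: "strict_mono r"
    "\<And>t. t \<in> T \<Longrightarrow> convergent (\<lambda>j. measure M (I (r j) \<inter> t))"
    using countable_family_convergent_subseq[OF T(1),
        of "\<lambda>j t. measure M (I j \<inter> t)" 0 "measure M (space M)"] bounded_measure by auto
  show thesis
  proof (rule that[OF r(1)])
    fix x assume "x \<in> space M"
    then show "convergent (\<lambda>j. measure M (I (r j) \<inter> Pair x -` S))"
      using assms(2) r(2) by (intro sections)
  qed
qed

text \<open>Reverse Fatou for sets: the tail unions decrease to the limsup and each contains some
  \<open>I n\<close>, and continuity from above holds since the measure is finite. The limsup is
  taken in the lattice of sets: the points lying in infinitely many \<open>I j\<close>.\<close>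

lemma emeasure_limsup_ge:
  assumes "\<And>j. I j \<in> sets M" and "\<And>j. c \<le> emeasure M (I j)"
  shows "c \<le> emeasure M (limsup I)"
proof -
  have "emeasure M (\<Inter>n. \<Union>k\<in>{n..}. I k) = (INF n. emeasure M (\<Union>k\<in>{n..}. I k))"
    using assms(1) by (intro INF_emeasure_decseq[symmetric]) (auto simp: decseq_def, force)
  moreover have "c \<le> emeasure M (\<Union>k\<in>{n..}. I k)" for n
    using assms(1) by (intro order_trans[OF assms(2)[of n] emeasure_mono]) auto
  ultimately show ?thesis
    by (simp add: limsup_INF_SUP INF_greatest)
qed

end

section \<open>Borel-Cantelli on the square of a limsup set\<close>

lemma rapidly_decaying_subseq:
  fixes a :: "nat \<Rightarrow> real"
  assumes "a \<longlonglongrightarrow> 0" and "\<And>j. 0 \<le> a j"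
  obtains t where "strict_mono t" "summable (\<lambda>j. a (t j))"
proof -
  have "\<exists>N. \<forall>n\<ge>N. a n < (1/2)^j" for j
    using order_tendstoD(2)[OF assms(1), of "(1/2)^j"] by (simp add: eventually_sequentially)
  then have "\<exists>n>m. a n < (1/2)^j" for m j
    by (meson le_add1 le_add2 less_eq_Suc_le)
  then obtain s where s: "\<And>m j. s m j > m" "\<And>m j. a (s m j) < (1/2)^j" by metis
  \<comment> \<open>\<open>t (Suc j)\<close> is chosen beyond \<open>t j\<close> with exponent
    \<open>Suc j\<close>, and \<open>t 0\<close> with exponent 0, so the bound
    \<open>a (t j) < (1/2)^j\<close> holds from \<open>j = 0\<close> on.\<close>
  define t where "t = rec_nat (s 0 0) (\<lambda>j m. s m (Suc j))"
  have "strict_mono t" by (intro strict_monoI_Suc) (simp add: t_def s)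
  moreover have "a (t j) \<le> (1/2)^j" for j
    using s(2)[of _ j] by (cases j) (simp_all add: t_def less_imp_le del: power_Suc)
  then have "summable (\<lambda>j. a (t j))"
    using assms(2) by (intro summable_comparison_test[OF _ summable_geometric[of "1/2::real"]]) auto
  ultimately show ?thesis using that by blast
qed

text \<open>Both factors of the square vary with \<open>j\<close>, so they are decoupled. Replacing
  the section measures \<open>H j\<close> by their limit \<open>h\<close> costs only an
  \<open>L1\<close> error; the first factor is then handled against the fixed density
  \<open>h\<close>, and the second against the fixed set \<open>B\<close> obtained from the
  first.\<close>

lemma (in prob_space) null_square_of_limsup:
  assumes S[measurable]: "S \<in> sets (M \<Otimes>\<^sub>M M)" and I[measurable]: "\<And>j. I j \<in> sets M"
    and lim: "(\<lambda>j. measure (M \<Otimes>\<^sub>M M) (I j \<times> I j \<inter> S)) \<longlonglongrightarrow> 0"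
  obtains r :: "nat \<Rightarrow> nat" where "strict_mono r"
    "limsup (I \<circ> r) \<times> limsup (I \<circ> r) \<inter> S \<in> null_sets (M \<Otimes>\<^sub>M M)"
proof -
  interpret P: pair_prob_space M M ..
  obtain r1 :: "nat \<Rightarrow> nat" where r1: "strict_mono r1"
    "\<And>x. x \<in> space M \<Longrightarrow> convergent (\<lambda>j. measure M (I (r1 j) \<inter> Pair x -` S))"
    using sections_convergent_subseq[OF S, of I] I by blast
  define H where "H j x = measure M (I (r1 j) \<inter> Pair x -` S)" for j x
  define h where "h x = lim (\<lambda>j. H j x)" for x
  have H01: "0 \<le> H j x" "H j x \<le> 1" for j x
    by (auto simp: H_def)
  have H_meas[measurable]: "H j \<in> borel_measurable M" for j
  proof -
    have "(\<lambda>x. enn2real (emeasure M (Pair x -` (space M \<times> I (r1 j) \<inter> S)))) \<in> borel_measurable M"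
      by (intro borel_measurable_enn2real measurable_emeasure_Pair) simp
    moreover have "Pair x -` (space M \<times> I (r1 j) \<inter> S) = I (r1 j) \<inter> Pair x -` S" if "x \<in> space M" for x
      using that by auto
    ultimately show ?thesis
      by (simp add: H_def[abs_def] measure_def cong: measurable_cong)
  qed
  have H_lim: "(\<lambda>j. H j x) \<longlonglongrightarrow> h x" if "x \<in> space M" for x
    using r1(2)[OF that] unfolding h_def H_def convergent_LIMSEQ_iff .
  have h01: "0 \<le> h x" "h x \<le> 1" if "x \<in> space M" for x
    using H_lim[OF that] H01 by (auto intro: LIMSEQ_le_const LIMSEQ_le_const2)
  have diff01: "\<bar>H j x - h x\<bar> \<le> 1" if "x \<in> space M" for j x
    using H01[of j x] h01[OF that] by linarith
  have [measurable]: "h \<in> borel_measurable M"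
    unfolding h_def by measurable
  \<comment> \<open>Fubini with a free first factor \<open>A\<close>: it is used for the moving set
    \<open>J j\<close> and later for the fixed set \<open>B\<close>.\<close>
  have H_sect: "measure (M \<Otimes>\<^sub>M M) (A \<times> I (r1 j) \<inter> S) = (\<integral>x. indicator A x * H j x \<partial>M)"
    if [measurable]: "A \<in> sets M" for A j
  proof -
    have "emeasure (M \<Otimes>\<^sub>M M) (A \<times> I (r1 j) \<inter> S) =
        (\<integral>\<^sup>+x. emeasure M (Pair x -` (A \<times> I (r1 j) \<inter> S)) \<partial>M)"
      by (rule emeasure_pair_measure_alt) simp
    also have "\<dots> = (\<integral>\<^sup>+x. ennreal (indicator A x * H j x) \<partial>M)"
    proof (intro nn_integral_cong)
      fix x
      have "Pair x -` (A \<times> I (r1 j) \<inter> S) = (if x \<in> A then I (r1 j) \<inter> Pair x -` S else {})"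
        by auto
      then show "emeasure M (Pair x -` (A \<times> I (r1 j) \<inter> S)) = ennreal (indicator A x * H j x)"
        by (simp add: H_def emeasure_eq_measure)
    qed
    finally show ?thesis
      by (simp add: measure_def integral_eq_nn_integral H01)
  qed
  define a where "a j = (\<integral>x. \<bar>H j x - h x\<bar> \<partial>M)" for j
  define b where "b j = measure (M \<Otimes>\<^sub>M M) (I (r1 j) \<times> I (r1 j) \<inter> S)" for j
  \<comment> \<open>Pointwise convergence becomes \<open>L1\<close> convergence, with the constant 1
    as dominating function.\<close>
  have "a \<longlonglongrightarrow> (\<integral>x. 0 \<partial>M)"
    unfolding a_def
  proof (rule integral_dominated_convergence)
    show "AE x in M. (\<lambda>j. \<bar>H j x - h x\<bar>) \<longlonglongrightarrow> 0"
      using H_lim by (intro AE_I2) (auto simp: LIM_zero tendsto_rabs_zero)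
    show "AE x in M. norm \<bar>H j x - h x\<bar> \<le> 1" for j
      using diff01 by simp
  qed auto
  moreover have "b \<longlonglongrightarrow> 0"
    using LIMSEQ_subseq_LIMSEQ[OF lim r1(1)] by (simp add: b_def[abs_def] comp_def)
  \<comment> \<open>Adding the two null sequences lets one further subsequence make both
    summable.\<close>
  ultimately have "(\<lambda>j. a j + b j) \<longlonglongrightarrow> 0"
    using tendsto_add[of a 0 sequentially b 0] by simp
  moreover have ab0: "0 \<le> a j" "0 \<le> b j" for j
    by (simp_all add: a_def b_def)
  ultimately obtain t where t: "strict_mono t" "summable (\<lambda>j. a (t j) + b (t j))"
    using rapidly_decaying_subseq[of "\<lambda>j. a j + b j"] by auto
  define J where "J j = I (r1 (t j))" for j
  have J[measurable]: "J j \<in> sets M" for j by (simp add: J_def)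
  define B where "B = limsup J"
  have B[measurable]: "B \<in> sets M" unfolding B_def by measurable
  have int_h: "integrable M (\<lambda>x. indicator A x * h x)"
    "integrable M (\<lambda>x. indicator A x * H j x)" "integrable M (\<lambda>x. \<bar>H j x - h x\<bar>)"
    if [measurable]: "A \<in> sets M" for A j
    using H01 h01 diff01
    by (auto intro!: integrable_const_bound[where B = 1] AE_I2 simp: indicator_def)
  \<comment> \<open>Both directions are needed: \<open>h\<close> is bounded through
    \<open>H j\<close> over \<open>J j\<close>, and \<open>H j\<close> through \<open>h\<close> over
    \<open>B\<close>.\<close>
  have cmp: "(\<integral>x. indicator A x * u x \<partial>M) \<le> (\<integral>x. indicator A x * v x \<partial>M) + a j"
    if [measurable]: "A \<in> sets M" and uv: "u = h \<and> v = H j \<or> u = H j \<and> v = h" for A u v j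
  proof -
    have "(\<integral>x. indicator A x * u x \<partial>M) \<le> (\<integral>x. indicator A x * v x + \<bar>H j x - h x\<bar> \<partial>M)"
      using uv int_h[of A] by (intro integral_mono) (auto simp: indicator_def)
    also have "\<dots> = (\<integral>x. indicator A x * v x \<partial>M) + a j"
      using uv int_h[of A] unfolding a_def by (intro Bochner_Integration.integral_add) auto
    finally show ?thesis .
  qed
  \<comment> \<open>First Borel-Cantelli, in the measure with density \<open>h\<close>: the mass of
    \<open>J j\<close> is at most the mass of its square within \<open>S\<close> plus the
    \<open>L1\<close> error.\<close>
  have B_null: "(\<integral>x. indicator B x * h x \<partial>M) = 0"
  proof -
    have em: "emeasure (density M h) A = ennreal (\<integral>x. indicator A x * h x \<partial>M)"
      if [measurable]: "A \<in> sets M" for A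
    proof -
      have "emeasure (density M h) A = (\<integral>\<^sup>+x. ennreal (h x) * indicator A x \<partial>M)"
        by (intro emeasure_density) simp_all
      also have "\<dots> = (\<integral>\<^sup>+x. ennreal (indicator A x * h x) \<partial>M)"
        by (intro nn_integral_cong) (simp add: indicator_def)
      also have "\<dots> = ennreal (\<integral>x. indicator A x * h x \<partial>M)"
        using int_h(1)[of A] h01 by (intro nn_integral_eq_integral AE_I2) (auto simp: indicator_def)
      finally show ?thesis .
    qed
    have nn: "0 \<le> (\<integral>x. indicator A x * h x \<partial>M)" for A
      using h01 by (intro integral_nonneg_AE AE_I2) (auto simp: indicator_def)
    have "limsup J \<in> null_sets (density M h)"
    proof (rule borel_cantelli_limsup1)
      have "measure (density M h) (J j) \<le> a (t j) + b (t j)" for j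
        using cmp[of "J j" h "H (t j)" "t j"] em[of "J j"] nn[of "J j"] H_sect[of "J j" "t j"]
        by (simp add: measure_def b_def J_def)
      then show "summable (\<lambda>j. measure (density M h) (J j))"
        by (intro summable_comparison_test[OF _ t(2)]) auto
    qed (simp_all add: em)
    then have "ennreal (\<integral>x. indicator B x * h x \<partial>M) = 0"
      using em[OF B] by (simp add: B_def null_sets_def)
    with nn[of B] show ?thesis by simp
  qed
  \<comment> \<open>Second Borel-Cantelli, in the product: by Fubini
    \<open>B \<times> J j \<inter> S\<close> has measure equal to the integral of
    \<open>H (t j)\<close> over \<open>B\<close>. The integral of \<open>h\<close> over
    \<open>B\<close> is 0, which leaves only the \<open>L1\<close> error.\<close>
  have "limsup (\<lambda>j. B \<times> J j \<inter> S) \<in> null_sets (M \<Otimes>\<^sub>M M)"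
  proof (rule borel_cantelli_limsup1)
    have "measure (M \<Otimes>\<^sub>M M) (B \<times> J j \<inter> S) \<le> a (t j) + b (t j)" for j
      using cmp[of B "H (t j)" h "t j"] H_sect[OF B, of "t j"] B_null ab0(2)[of "t j"]
      by (simp add: J_def)
    then show "summable (\<lambda>j. measure (M \<Otimes>\<^sub>M M) (B \<times> J j \<inter> S))"
      by (intro summable_comparison_test[OF _ t(2)]) auto
  qed (simp_all add: P.emeasure_eq_measure)
  \<comment> \<open>With the first factor fixed, the limsup acts on the second factor alone and
    produces exactly the square of \<open>B\<close> within \<open>S\<close>.\<close>
  moreover have "limsup (\<lambda>j. B \<times> J j \<inter> S) = B \<times> limsup J \<inter> S"
    by (auto simp: limsup_INF_SUP)
  moreover have "J = I \<circ> (r1 \<circ> t)" by (simp add: J_def fun_eq_iff)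
  ultimately show ?thesis
    using that[of "r1 \<circ> t"] strict_mono_o[OF r1(1) t(1)] by (simp add: B_def)
qed

section \<open>From cut-norm convergence to small measure on the support\<close>

text \<open>The support is split at the level \<open>1 / (n+1)\<close>. The part \<open>Z n\<close>
  below it decreases to the empty set, so a large \<open>n\<close> makes its measure small; above it
  Markov's inequality applies with the factor \<open>n+1\<close>, which stays fixed while
  \<open>j\<close> grows.\<close>

lemma (in finite_measure) measure_support_tendsto_0:
  fixes f :: "'a \<Rightarrow> real"
  assumes f: "integrable M f" "\<And>x. x \<in> space M \<Longrightarrow> 0 \<le> f x"
    and E[measurable]: "\<And>j. E j \<in> sets M"
    and lim: "(\<lambda>j. set_lebesgue_integral M (E j) f) \<longlonglongrightarrow> 0"
  shows "(\<lambda>j. measure M (E j \<inter> {x \<in> space M. 0 < f x})) \<longlonglongrightarrow> 0"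
proof (rule order_tendstoI)
  fix e :: real assume "0 < e"
  have [measurable]: "f \<in> borel_measurable M" using f(1) by auto
  define Z where "Z n = {x \<in> space M. 0 < f x \<and> f x < 1 / real (Suc n)}" for n
  have [measurable]: "Z n \<in> sets M" for n by (simp add: Z_def)
  have "(\<lambda>n. measure M (Z n)) \<longlonglongrightarrow> measure M (\<Inter>n. Z n)"
  proof (rule finite_Lim_measure_decseq)
    show "decseq Z"
      by (auto simp: decseq_def Z_def intro: order.strict_trans2[OF _ divide_left_mono])
  qed auto
  moreover have "(\<Inter>n. Z n) = {}"
  proof -
    have "\<exists>n. x \<notin> Z n" for x
    proof (cases "0 < f x")
      case True
      then obtain n where "inverse (real (Suc n)) < f x" using reals_Archimedean by blast
      then show ?thesis by (intro exI[of _ n]) (simp add: Z_def inverse_eq_divide)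
    qed (simp add: Z_def)
    then show ?thesis by auto
  qed
  ultimately have "(\<lambda>n. measure M (Z n)) \<longlonglongrightarrow> 0" by simp
  then have "\<forall>\<^sub>F n in sequentially. measure M (Z n) < e/2"
    using \<open>0 < e\<close> by (intro order_tendstoD(2)[of _ 0]) auto
  then obtain n where n: "measure M (Z n) < e/2"
    by (auto simp: eventually_sequentially)
  have le: "measure M (E j \<inter> {x \<in> space M. 0 < f x}) \<le>
      measure M (Z n) + real (Suc n) * set_lebesgue_integral M (E j) f" for j
  proof -
    have int: "integrable M (\<lambda>x. indicator (E j) x * f x)"
      using integrable_mult_indicator[OF E f(1)] by simp
    have iz: "integrable M (indicator (Z n) :: 'a \<Rightarrow> real)"
      by (intro integrable_real_indicator) (measurable, simp add: less_top[symmetric])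
    have "measure M (E j \<inter> {x \<in> space M. 0 < f x}) =
        (\<integral>x. indicator (E j \<inter> {x \<in> space M. 0 < f x}) x \<partial>M)"
      by simp
    also have "\<dots> \<le> (\<integral>x. indicator (Z n) x + real (Suc n) * (indicator (E j) x * f x) \<partial>M)"
    proof (rule integral_mono)
      fix x assume x: "x \<in> space M"
      show "indicator (E j \<inter> {x \<in> space M. 0 < f x}) x \<le>
          indicator (Z n) x + real (Suc n) * (indicator (E j) x * f x)"
      proof (cases "x \<in> E j \<and> 0 < f x \<and> 1 / real (Suc n) \<le> f x")
        case True
        then have "1 \<le> real (Suc n) * f x" by (simp add: field_simps)
        with True x show ?thesis by (simp add: indicator_def)
      next
        case False
        with x f(2)[OF x] show ?thesis by (auto simp: indicator_def Z_def)
      qed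
    next
      show "integrable M (indicator (E j \<inter> {x \<in> space M. 0 < f x}) :: 'a \<Rightarrow> real)"
        by (intro integrable_real_indicator) (measurable, simp add: less_top[symmetric])
      show "integrable M (\<lambda>x. indicator (Z n) x + real (Suc n) * (indicator (E j) x * f x))"
        by (intro Bochner_Integration.integrable_add integrable_mult_right int iz)
    qed
    also have "\<dots> = measure M (Z n) + real (Suc n) * (\<integral>x. indicator (E j) x * f x \<partial>M)"
      by (subst Bochner_Integration.integral_add[OF iz integrable_mult_right[OF int]]) simp
    finally show ?thesis by (simp add: set_lebesgue_integral_def)
  qed
  have "(\<lambda>j. real (Suc n) * set_lebesgue_integral M (E j) f) \<longlonglongrightarrow> real (Suc n) * 0"
    by (intro tendsto_intros lim)
  then have "\<forall>\<^sub>F j in sequentially. real (Suc n) * set_lebesgue_integral M (E j) f < e/2"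
    using \<open>0 < e\<close> by (intro order_tendstoD(2)[of _ 0]) (simp_all del: of_nat_Suc)
  then show "\<forall>\<^sub>F j in sequentially. measure M (E j \<inter> {x \<in> space M. 0 < f x}) < e"
  proof (rule eventually_mono)
    fix j assume "real (Suc n) * set_lebesgue_integral M (E j) f < e/2"
    with le[of j] n show "measure M (E j \<inter> {x \<in> space M. 0 < f x}) < e" by linarith
  qed
qed (simp add: less_le_trans[OF _ measure_nonneg])

lemma (in prob_space) graphon_integrable:
  assumes "graphon M W"
  shows "integrable (M \<Otimes>\<^sub>M M) W"
proof -
  interpret P: pair_prob_space M M ..
  show ?thesis
    using assms unfolding graphon_def
    by (intro P.integrable_const_bound[where B = 1] AE_I2) (auto simp: space_pair_measure)
qed

text \<open>The cut-norm is a supremum in the reals, so a single term lies below it only once the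
  family is bounded above; \<open>K\<close> is such a bound, uniform over all rectangles.\<close>

lemma (in prob_space) set_integral_le_cut_norm:
  assumes U: "U \<in> borel_measurable (M \<Otimes>\<^sub>M M)"
    "\<And>p. p \<in> space (M \<Otimes>\<^sub>M M) \<Longrightarrow> \<bar>U p\<bar> \<le> K"
    and ST: "S \<in> sets M" "T \<in> sets M"
  shows "\<bar>set_lebesgue_integral (M \<Otimes>\<^sub>M M) (S \<times> T) U\<bar> \<le> cut_norm M U"
proof -
  interpret P: pair_prob_space M M ..
  have "\<bar>set_lebesgue_integral (M \<Otimes>\<^sub>M M) (A \<times> B) U\<bar> \<le> K"
    if [measurable]: "A \<in> sets M" "B \<in> sets M" for A B
  proof -
    have int: "integrable (M \<Otimes>\<^sub>M M) U"
      using U by (intro P.integrable_const_bound[where B = K] AE_I2) auto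
    have "\<bar>set_lebesgue_integral (M \<Otimes>\<^sub>M M) (A \<times> B) U\<bar> \<le> (\<integral>p. \<bar>indicator (A \<times> B) p * U p\<bar> \<partial>(M \<Otimes>\<^sub>M M))"
      unfolding set_lebesgue_integral_def real_scaleR_def by (rule integral_abs_bound)
    also have "\<dots> \<le> (\<integral>p. K \<partial>(M \<Otimes>\<^sub>M M))"
    proof (rule integral_mono)
      show "integrable (M \<Otimes>\<^sub>M M) (\<lambda>p. \<bar>indicator (A \<times> B) p * U p\<bar>)"
        using integrable_mult_indicator[OF _ int, of "A \<times> B"] by simp
      show "\<bar>indicator (A \<times> B) p * U p\<bar> \<le> K" if "p \<in> space (M \<Otimes>\<^sub>M M)" for p
        using U(2)[OF that] by (auto simp: indicator_def)
    qed simp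
    finally show ?thesis by (simp add: P.prob_space)
  qed
  then have "bdd_above ((\<lambda>(S, T). \<bar>set_lebesgue_integral (M \<Otimes>\<^sub>M M) (S \<times> T) U\<bar>) ` (sets M \<times> sets M))"
    by (auto intro!: bdd_aboveI2)
  from cSUP_upper[OF _ this, of "(S, T)"] ST show ?thesis
    by (simp add: cut_norm_def)
qed

text \<open>\<open>V\<close> vanishes almost everywhere on \<open>I \<times> I\<close>, so testing
  the cut-norm on this one square gives exactly minus the integral of \<open>W\<close>.\<close>

lemma (in prob_space) set_integral_independent_le_cut_norm:
  assumes V: "graphon M V" and W: "graphon M W" and I: "I \<in> independent_sets M V"
  shows "set_lebesgue_integral (M \<Otimes>\<^sub>M M) (I \<times> I) W \<le> cut_norm M (\<lambda>p. V p - W p)"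
proof -
  have Im: "I \<in> sets M" and ae: "AE p in M \<Otimes>\<^sub>M M. p \<in> I \<times> I \<longrightarrow> V p = 0"
    using I by (auto simp: independent_sets_def)
  have [measurable]: "V \<in> borel_measurable (M \<Otimes>\<^sub>M M)" "W \<in> borel_measurable (M \<Otimes>\<^sub>M M)"
    using V W by (auto simp: graphon_def)
  have si: "set_integrable (M \<Otimes>\<^sub>M M) (I \<times> I) V" "set_integrable (M \<Otimes>\<^sub>M M) (I \<times> I) W"
    unfolding set_integrable_def
    by (rule integrable_mult_indicator[OF pair_measureI[OF Im Im] graphon_integrable], fact)+
  have "set_lebesgue_integral (M \<Otimes>\<^sub>M M) (I \<times> I) V = 0"
    unfolding set_lebesgue_integral_def
    using ae by (intro integral_eq_zero_AE) (auto simp: indicator_def)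
  then have "set_lebesgue_integral (M \<Otimes>\<^sub>M M) (I \<times> I) (\<lambda>p. V p - W p) =
      - set_lebesgue_integral (M \<Otimes>\<^sub>M M) (I \<times> I) W"
    using set_integral_diff(2)[OF si] by simp
  moreover have "\<bar>set_lebesgue_integral (M \<Otimes>\<^sub>M M) (I \<times> I) (\<lambda>p. V p - W p)\<bar> \<le> cut_norm M (\<lambda>p. V p - W p)"
  proof (rule set_integral_le_cut_norm)
    fix p assume "p \<in> space (M \<Otimes>\<^sub>M M)"
    then obtain x y where p: "p = (x, y)" "x \<in> space M" "y \<in> space M"
      by (auto simp: space_pair_measure)
    with V W have "0 \<le> V p" "V p \<le> 1" "0 \<le> W p" "W p \<le> 1"
      unfolding graphon_def by auto
    then show "\<bar>V p - W p\<bar> \<le> 1" by linarith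
  qed (use Im in auto)
  ultimately show ?thesis by linarith
qed

section \<open>Transfer of fractional cliques and lower semicontinuity\<close>

lemma (in prob_space) eventually_scaled_fractional_clique:
  assumes W: "graphon M W" and Wn: "\<And>n. graphon M (Wn n)"
    and lim: "(\<lambda>n. cut_norm M (\<lambda>p. Wn n p - W p)) \<longlonglongrightarrow> 0"
    and f: "f \<in> fractional_cliques M W" and fin: "(\<integral>\<^sup>+x. ennreal (f x) \<partial>M) \<noteq> \<infinity>"
    and e: "0 < e"
  shows "\<forall>\<^sub>F n in sequentially. (\<lambda>x. f x / (1 + e)) \<in> fractional_cliques M (Wn n)"
proof (rule ccontr)
  interpret P: pair_prob_space M M ..
  have [measurable]: "f \<in> borel_measurable M" and f0: "\<And>x. x \<in> space M \<Longrightarrow> 0 \<le> f x"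
    and f1: "\<And>I. I \<in> independent_sets M W \<Longrightarrow> (\<integral>\<^sup>+x\<in>I. ennreal (f x) \<partial>M) \<le> 1"
    using f by (auto simp: fractional_cliques_def)
  have [measurable]: "W \<in> borel_measurable (M \<Otimes>\<^sub>M M)"
    using W by (auto simp: graphon_def)
  have W0: "0 \<le> W p" if "p \<in> space (M \<Otimes>\<^sub>M M)" for p
    using W that by (auto simp: graphon_def space_pair_measure)
  \<comment> \<open>Violation of the clique condition by \<open>f / (1 + e)\<close>, rescaled to a
    condition on \<open>f\<close>.\<close>
  let ?bad = "\<lambda>n. \<exists>I\<in>independent_sets M (Wn n). ennreal (1 + e) < (\<integral>\<^sup>+x\<in>I. ennreal (f x) \<partial>M)"
  have good: "(\<lambda>x. f x / (1 + e)) \<in> fractional_cliques M (Wn n)" if "\<not> ?bad n" for n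
  proof -
    have "(\<integral>\<^sup>+x\<in>I. ennreal (f x / (1 + e)) \<partial>M) \<le> 1" if "I \<in> independent_sets M (Wn n)" for I
    proof -
      have [measurable]: "I \<in> sets M" using that by (simp add: independent_sets_def)
      have "(\<integral>\<^sup>+x\<in>I. ennreal (f x / (1 + e)) \<partial>M) = (\<integral>\<^sup>+x. (ennreal (f x) * indicator I x) / ennreal (1 + e) \<partial>M)"
        using f0 e by (intro nn_integral_cong)
          (auto simp: indicator_def divide_ennreal simp del: ennreal_plus)
      also have "\<dots> = (\<integral>\<^sup>+x\<in>I. ennreal (f x) \<partial>M) / ennreal (1 + e)"
        by (intro nn_integral_divide) simp
      also have "\<dots> \<le> ennreal (1 + e) / ennreal (1 + e)"
        using \<open>\<not> ?bad n\<close> that by (intro divide_right_mono_ennreal) (auto simp: not_less)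
      also have "\<dots> = 1" using e by (simp add: divide_ennreal)
      finally show ?thesis .
    qed
    then show ?thesis using f0 e by (auto simp: fractional_cliques_def)
  qed
  assume "\<not> ?thesis"
  then have "\<exists>\<^sub>F n in sequentially. ?bad n"
    using good by (auto simp: not_eventually elim!: frequently_elim1)
  then have "infinite {n. ?bad n}"
    unfolding frequently_cofinite[symmetric] cofinite_eq_sequentially .
  then obtain s :: "nat \<Rightarrow> nat" where s: "strict_mono s" "\<forall>j. s j \<in> {n. ?bad n}"
    by (blast dest: infinite_enumerate)
  then have "\<forall>j. ?bad (s j)" by simp
  then obtain I where I: "\<And>j. I j \<in> independent_sets M (Wn (s j))"
    "\<And>j. ennreal (1 + e) < (\<integral>\<^sup>+x\<in>I j. ennreal (f x) \<partial>M)" by metis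
  have Im[measurable]: "I j \<in> sets M" for j using I(1)[of j] by (simp add: independent_sets_def)
  \<comment> \<open>As \<open>W\<close> is nonnegative, a measurable set is independent in
    \<open>W\<close> once its square meets \<open>S\<close> in a null set.\<close>
  define S where "S = {p \<in> space (M \<Otimes>\<^sub>M M). 0 < W p}"
  have [measurable]: "S \<in> sets (M \<Otimes>\<^sub>M M)" by (simp add: S_def)
  have "(\<lambda>j. set_lebesgue_integral (M \<Otimes>\<^sub>M M) (I j \<times> I j) W) \<longlonglongrightarrow> 0"
  proof (rule tendsto_sandwich[OF _ _ tendsto_const])
    show "(\<lambda>j. cut_norm M (\<lambda>p. Wn (s j) p - W p)) \<longlonglongrightarrow> 0"
      using LIMSEQ_subseq_LIMSEQ[OF lim s(1)] by (simp add: comp_def)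
    show "\<forall>\<^sub>F j in sequentially. 0 \<le> set_lebesgue_integral (M \<Otimes>\<^sub>M M) (I j \<times> I j) W"
      unfolding set_lebesgue_integral_def using W0
      by (intro always_eventually allI integral_nonneg_AE AE_I2) (auto simp: indicator_def)
    show "\<forall>\<^sub>F j in sequentially. set_lebesgue_integral (M \<Otimes>\<^sub>M M) (I j \<times> I j) W
        \<le> cut_norm M (\<lambda>p. Wn (s j) p - W p)"
      using set_integral_independent_le_cut_norm[OF Wn W I(1)] by simp
  qed
  then have "(\<lambda>j. measure (M \<Otimes>\<^sub>M M) (I j \<times> I j \<inter> S)) \<longlonglongrightarrow> 0"
    unfolding S_def using W0 graphon_integrable[OF W]
    by (intro P.measure_support_tendsto_0) auto
  then obtain r :: "nat \<Rightarrow> nat" where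
    null: "limsup (I \<circ> r) \<times> limsup (I \<circ> r) \<inter> S \<in> null_sets (M \<Otimes>\<^sub>M M)"
    using null_square_of_limsup[of S I] by auto
  define B where "B = limsup (I \<circ> r)"
  have [measurable]: "B \<in> sets M"
    unfolding B_def comp_def by measurable
  have "B \<in> independent_sets M W"
  proof -
    have "AE p in M \<Otimes>\<^sub>M M. p \<notin> B \<times> B \<inter> S"
      using AE_not_in[OF null] by (simp add: B_def)
    then have "AE p in M \<Otimes>\<^sub>M M. p \<in> B \<times> B \<longrightarrow> W p = 0"
      using AE_space by eventually_elim (use W0 in \<open>force simp: S_def\<close>)
    then show ?thesis by (simp add: independent_sets_def)
  qed
  then have le1: "emeasure (density M f) B \<le> 1"
    using f1 by (simp add: emeasure_density)
  \<comment> \<open>Finiteness of the integral of \<open>f\<close> makes it the density of a finite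
    measure, so the excess \<open>1 + e\<close> on every \<open>I j\<close> survives on the limsup
    set \<open>B\<close>.\<close>
  interpret N: finite_measure "density M f"
    using fin by (intro finite_measureI) (simp add: emeasure_density cong: nn_integral_cong)
  have "ennreal (1 + e) \<le> emeasure (density M f) B"
    unfolding B_def
    using I(2) by (intro N.emeasure_limsup_ge) (auto simp: emeasure_density less_imp_le)
  with le1 have "ennreal (1 + e) \<le> 1" by (rule order_trans[rotated])
  with e show False by (simp add: ennreal_le_1)
qed

text \<open>The scaled clique eventually competes in \<open>omega_frac M (Wn n)\<close>, which
  bounds the liminf below by the integral of \<open>f\<close> divided by \<open>1 + e\<close>; then
  \<open>e\<close> tends to 0 along \<open>1 / (n+1)\<close>.\<close>

lemma (in prob_space) nn_integral_fractional_clique_le_liminf: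
  assumes W: "graphon M W" and Wn: "\<And>n. graphon M (Wn n)"
    and lim: "(\<lambda>n. cut_norm M (\<lambda>p. Wn n p - W p)) \<longlonglongrightarrow> 0"
    and f: "f \<in> fractional_cliques M W" and fin: "(\<integral>\<^sup>+x. ennreal (f x) \<partial>M) \<noteq> \<infinity>"
  shows "(\<integral>\<^sup>+x. ennreal (f x) \<partial>M) \<le> liminf (\<lambda>n. omega_frac M (Wn n))" (is "?F \<le> ?L")
proof -
  have [measurable]: "f \<in> borel_measurable M" and f0: "\<And>x. x \<in> space M \<Longrightarrow> 0 \<le> f x"
    using f by (auto simp: fractional_cliques_def)
  have bound: "?F / ennreal (1 + e) \<le> ?L" if "0 < e" for e
  proof (rule Liminf_bounded)
    have "?F / ennreal (1 + e) = (\<integral>\<^sup>+x. ennreal (f x / (1 + e)) \<partial>M)"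
      using f0 that by (subst nn_integral_divide[symmetric])
        (auto intro!: nn_integral_cong simp: divide_ennreal simp del: ennreal_plus)
    then show "\<forall>\<^sub>F n in sequentially. ?F / ennreal (1 + e) \<le> omega_frac M (Wn n)"
      using eventually_scaled_fractional_clique[OF W Wn lim f fin that]
      by (auto simp: omega_frac_def elim!: eventually_mono intro: SUP_upper2)
  qed
  obtain c where c: "?F = ennreal c" "0 \<le> c" using fin by (cases ?F) auto
  have "(\<lambda>n. c / (1 + 1 / real (Suc n))) \<longlonglongrightarrow> c / (1 + 0)"
    by (intro tendsto_intros LIMSEQ_Suc[OF lim_1_over_n]) simp
  then have "(\<lambda>n. ennreal (c / (1 + 1 / real (Suc n)))) \<longlonglongrightarrow> ennreal c"
    by (intro tendsto_ennrealI) simp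
  moreover have "ennreal (c / (1 + 1 / real (Suc n))) \<le> ?L" for n
  proof -
    have "ennreal (c / (1 + 1 / real (Suc n))) = ?F / ennreal (1 + 1 / real (Suc n))"
      unfolding c(1) using c(2) by (intro divide_ennreal[symmetric]) (auto intro: add_pos_nonneg)
    also have "\<dots> \<le> ?L" by (rule bound) simp
    finally show ?thesis .
  qed
  ultimately show ?thesis unfolding c(1) by (intro LIMSEQ_le_const2) auto
qed

theorem theorem5p5:
  fixes M :: "'a measure"
    and W :: "'a \<times> 'a \<Rightarrow> real"
    and Wn :: "nat \<Rightarrow> 'a \<times> 'a \<Rightarrow> real"
  assumes "prob_space M" and "standard_borel M" and "atomless M"
    and "graphon M W" and "\<And>n. graphon M (Wn n)"
    and "(\<lambda>n. cut_norm M (\<lambda>p. Wn n p - W p)) \<longlonglongrightarrow> 0"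
  shows "omega_frac M W \<le> liminf (\<lambda>n. omega_frac M (Wn n))"
  unfolding omega_frac_def[of M W]
proof (rule SUP_least)
  interpret prob_space M by fact
  fix f assume f: "f \<in> fractional_cliques M W"
  then have [measurable]: "f \<in> borel_measurable M" and f0: "\<And>x. x \<in> space M \<Longrightarrow> 0 \<le> f x"
    by (auto simp: fractional_cliques_def)
  \<comment> \<open>Cliques of infinite integral are reached by truncation: \<open>g k\<close> is
    bounded, remains a fractional clique because it lies below \<open>f\<close>, and increases to
    \<open>f\<close>, so monotone convergence recovers the integral even when it is
    infinite.\<close>
  define g where "g k x = min (f x) (real k)" for k x
  have [measurable]: "g k \<in> borel_measurable M" for k by (simp add: g_def[abs_def])
  have g: "g k \<in> fractional_cliques M W" for k
  proof -
    have "(\<integral>\<^sup>+x\<in>I. ennreal (g k x) \<partial>M) \<le> 1" if "I \<in> independent_sets M W" for I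
    proof -
      have "(\<integral>\<^sup>+x\<in>I. ennreal (g k x) \<partial>M) \<le> (\<integral>\<^sup>+x\<in>I. ennreal (f x) \<partial>M)"
        by (intro nn_integral_mono mult_right_mono) (auto simp: g_def intro: ennreal_leI)
      also have "\<dots> \<le> 1" using f that by (auto simp: fractional_cliques_def)
      finally show ?thesis .
    qed
    then show ?thesis using f0 by (auto simp: fractional_cliques_def g_def)
  qed
  have "(\<integral>\<^sup>+x. ennreal (g k x) \<partial>M) \<le> (\<integral>\<^sup>+x. ennreal (real k) \<partial>M)" for k
    by (intro nn_integral_mono) (auto simp: g_def intro: ennreal_leI)
  then have fin: "(\<integral>\<^sup>+x. ennreal (g k x) \<partial>M) \<noteq> \<infinity>" for k
    using neq_top_trans[of "ennreal (real k)"] by (simp add: emeasure_space_1)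
  have "(\<integral>\<^sup>+x. ennreal (f x) \<partial>M) = (\<integral>\<^sup>+x. (SUP k. ennreal (g k x)) \<partial>M)"
  proof (intro nn_integral_cong antisym SUP_least)
    fix x
    obtain k where "f x \<le> real k" using real_arch_simple by blast
    then show "ennreal (f x) \<le> (SUP k. ennreal (g k x))"
      by (intro SUP_upper2[of k]) (auto simp: g_def)
  qed (auto simp: g_def intro: ennreal_leI)
  also have "\<dots> = (SUP k. \<integral>\<^sup>+x. ennreal (g k x) \<partial>M)"
    by (intro nn_integral_monotone_convergence_SUP)
      (auto simp: incseq_def le_fun_def g_def intro!: ennreal_leI min.mono)
  also have "\<dots> \<le> liminf (\<lambda>n. omega_frac M (Wn n))"
    by (intro SUP_least nn_integral_fractional_clique_le_liminf[OF assms(4-6) g fin])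
  finally show "(\<integral>\<^sup>+x. ennreal (f x) \<partial>M) \<le> liminf (\<lambda>n. omega_frac M (Wn n))" .
qed

end
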